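(* Any disagreement bound $f$ satisfies $$f\left(\tfrac kn\right)\ge \frac{2k}{n+k}\qquad\text{for all integers } k\ge2 \text{ and } n\ge 3k^2+6k.$$ (Here $\frac{2k}{n+k}=F(\frac kn)$ with $F(x)=\frac{2x}{1+x}$.)
   Context: A coupling of a collection of random variables $(X_i)_{i\in I}$ is a family $(X_i')_{i\in I}$ of random variables on one common probability space such that each $X_i'$ has the same law as $X_i$; primes are omitted. The total variation distance is $d_{\mathrm{TV}}(X,Y)=\sup_A|\mathbb P(X\in A)-\mathbb P(Y\in A)|$, over all measurable sets $A$. A function $f:[0,1]\to[0,1]$ is called a disagreement bound if for any finite collection of random variables there is a coupling of the variables such that any two of them, say $X$ and $Y$, satisfy $\mathbb P(X\neq Y)\le f(d_{\mathrm{TV}}(X,Y))$. *)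

theory Defs
  imports "HOL-Probability.Probability"
begin

text \<open>Random variables with values in the measurable space \<open>S\<close> (of which only the carrier and the
  sigma-algebra are used) may live on different sample spaces; \<open>X\<close> lives on \<open>M\<close>.\<close>

definition tv_dist :: "'s measure \<Rightarrow> 'a measure \<Rightarrow> ('a \<Rightarrow> 's) \<Rightarrow> 'b measure \<Rightarrow> ('b \<Rightarrow> 's) \<Rightarrow> real" where
  "tv_dist S M X N Y =
     (SUP A\<in>sets S. \<bar>measure (distr M S X) A - measure (distr N S Y) A\<bar>)"

definition is_coupling ::
  "'s measure \<Rightarrow> 'i set \<Rightarrow> ('i \<Rightarrow> 'a measure) \<Rightarrow> ('i \<Rightarrow> 'a \<Rightarrow> 's) \<Rightarrow> 'b measure \<Rightarrow> ('i \<Rightarrow> 'b \<Rightarrow> 's) \<Rightarrow> bool"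
where
  "is_coupling S I M X P X' \<longleftrightarrow>
     prob_space P \<and>
     (\<forall>i\<in>I. X' i \<in> P \<rightarrow>\<^sub>M S \<and> distr P S (X' i) = distr (M i) S (X i))"

text \<open>The condition under which \<open>X \<noteq> Y\<close> is an event for any two \<open>S\<close>-valued random variables on a
  common probability space. It holds for every standard Borel space and every countable discrete
  space.\<close>

definition measurable_diagonal :: "'s measure \<Rightarrow> bool" where
  "measurable_diagonal S \<longleftrightarrow>
     {p \<in> space (S \<Otimes>\<^sub>M S). fst p = snd p} \<in> sets (S \<Otimes>\<^sub>M S)"

text \<open>HOL cannot quantify over types inside a definition, so the three types below are fixed; this
  loses no generality.
  \<^item> Values: if \<open>S\<close> has a measurable diagonal, then countably many measurable sets separate its
    points, so it has at most continuum many points and is isomorphic to a measurable space whose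
    carrier is a set of reals. The sigma-algebra of \<open>S\<close> is arbitrary, not the Borel one.
  \<^item> Sample spaces of the given variables: every law on \<open>S\<close> is the law of the identity map on \<open>S\<close>
    equipped with that law.
  \<^item> Sample space of the coupling: any coupling may be replaced by the coordinate maps under its
    joint law, which lives on functions from indices to values.\<close>

definition disagreement_bound :: "(real \<Rightarrow> real) \<Rightarrow> bool" where
  "disagreement_bound f \<longleftrightarrow>
     f \<in> {0..1} \<rightarrow> {0..1} \<and>
     (\<forall>(S :: real measure) (I :: nat set) (M :: nat \<Rightarrow> real measure) (X :: nat \<Rightarrow> real \<Rightarrow> real).
        measurable_diagonal S \<longrightarrow> finite I \<longrightarrow>
        (\<forall>i\<in>I. prob_space (M i) \<and> X i \<in> M i \<rightarrow>\<^sub>M S) \<longrightarrow>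
        (\<exists>(P :: (nat \<Rightarrow> real) measure) X'.
           is_coupling S I M X P X' \<and>
           (\<forall>i\<in>I. \<forall>j\<in>I. i \<noteq> j \<longrightarrow>
              measure P {\<omega> \<in> space P. X' i \<omega> \<noteq> X' j \<omega>} \<le> f (tv_dist S (M i) (X i) (M j) (X j)))))"

end

theory Submission
  imports Defs
begin

text \<open>Let \<open>V\<close> have \<open>N = n + k\<close> points and, for each \<open>k\<close>-subset \<open>B\<close> of \<open>V\<close>, let \<open>X\<^sub>B\<close> be uniform on
  \<open>V - B\<close>. For disjoint \<open>A\<close>, \<open>B\<close> the total variation distance of \<open>X\<^sub>A\<close> and \<open>X\<^sub>B\<close> is \<open>k / n\<close>. A sample
  from a coupling colours the Kneser graph so that each vertex \<open>B\<close> gets a colour in \<open>V - B\<close>. Every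
  such colouring has at least the fraction \<open>2k / N\<close> of the edges bichromatic (with equality if \<open>B\<close>
  is coloured by the first point outside \<open>B\<close>), so averaging gives \<open>f (k / n) \<ge> 2k / N\<close>.

  With \<open>m\<close> vertices, degree \<open>d\<close> and all colour classes of size at most \<open>m / 2\<close>, each vertex has at
  least \<open>d - m / 2\<close> differently coloured neighbours, which suffices because \<open>d\<close> is close to \<open>m\<close> for
  \<open>N \<ge> 3k\<^sup>2 + 7k\<close>. Otherwise some colour \<open>v\<close> has a class \<open>C\<close> with more than \<open>m / 2\<close> vertices. Let \<open>S\<close>
  be the star of \<open>v\<close>, which is independent and disjoint from \<open>C\<close>, and \<open>W\<close> the remaining vertices. The
  star is incident to exactly the fraction \<open>2k / N\<close> of the edges, and moving \<open>W\<close> out of \<open>C\<close> makes at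
  most \<open>e(S, W)\<close> of these monochromatic while making \<open>e(W, C)\<close> others bichromatic; the
  latter is larger since \<open>W\<close> has fewer than \<open>m / 2\<close> vertices.\<close>

section \<open>Counting k-subsets: stars and disjoint sets\<close>

definition ksubsets :: "'a set \<Rightarrow> nat \<Rightarrow> 'a set set" where
  "ksubsets V k = {B. B \<subseteq> V \<and> card B = k}"

lemma finite_ksubsets [simp]: "finite V \<Longrightarrow> finite (ksubsets V k)"
  unfolding ksubsets_def by simp

lemma card_ksubsets: "finite V \<Longrightarrow> card (ksubsets V k) = card V choose k"
  unfolding ksubsets_def by (rule n_subsets)

lemma ksubsets_disjoint:
  "{B \<in> ksubsets V k. A \<inter> B = {}} = ksubsets (V - A) k"
  unfolding ksubsets_def by auto

text \<open>By Pascal's rule the k-subsets through \<open>v\<close> number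
  \<open>(card V - 1) choose (k - 1)\<close>; the absorption identity does the rest. The product
  form avoids division, and it is applied both to \<open>V\<close> and to
  \<open>V - A\<close>.\<close>

lemma card_ksubsets_star:
  assumes "finite V" "v \<in> V" "0 < k"
  shows "card V * card {B \<in> ksubsets V k. v \<in> B} = k * card (ksubsets V k)"
proof -
  have "ksubsets V k = {B \<in> ksubsets V k. v \<in> B} \<union> ksubsets (V - {v}) k"
    unfolding ksubsets_def by auto
  moreover have "{B \<in> ksubsets V k. v \<in> B} \<inter> ksubsets (V - {v}) k = {}"
    unfolding ksubsets_def by auto
  ultimately have "card (ksubsets V k) = card {B \<in> ksubsets V k. v \<in> B} + card (ksubsets (V - {v}) k)"
    using assms(1) by (metis card_Un_disjoint finite_Un finite_ksubsets)
  then have "card V choose k = card {B \<in> ksubsets V k. v \<in> B} + ((card V - 1) choose k)"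
    using assms by (simp add: card_ksubsets)
  moreover have "card V > 0"
    using assms card_gt_0_iff by blast
  ultimately have "card {B \<in> ksubsets V k. v \<in> B} = (card V - 1) choose (k - 1)"
    using choose_reduce_nat[of "card V" k] assms(3) by simp
  then show ?thesis
    using times_binomial_minus1_eq[of k "card V"] assms by (simp add: card_ksubsets)
qed

text \<open>Union bound: a k-subset meeting \<open>A\<close> lies in the star of one of the
  \<open>k\<close> points of \<open>A\<close>, and each star is the fraction
  \<open>k / card V\<close> of all k-subsets.\<close>

lemma card_ksubsets_meeting:
  assumes "finite V" "A \<in> ksubsets V k" "0 < k"
  shows "card V * card (ksubsets V k) \<le> card V * card (ksubsets (V - A) k) + k\<^sup>2 * card (ksubsets V k)"
proof -
  have A: "A \<subseteq> V" "card A = k"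
    using assms by (auto simp: ksubsets_def)
  let ?M = "\<Union>a\<in>A. {B \<in> ksubsets V k. a \<in> B}"
  have "finite A" using A assms finite_subset by blast
  have "ksubsets V k \<subseteq> ksubsets (V - A) k \<union> ?M"
    unfolding ksubsets_def by auto
  then have "card (ksubsets V k) \<le> card (ksubsets (V - A) k \<union> ?M)"
    using assms(1) \<open>finite A\<close> by (intro card_mono) auto
  also have "\<dots> \<le> card (ksubsets (V - A) k) + card ?M"
    by (rule card_Un_le)
  also have "\<dots> \<le> card (ksubsets (V - A) k) + (\<Sum>a\<in>A. card {B \<in> ksubsets V k. a \<in> B})"
    using card_UN_le[OF \<open>finite A\<close>] by simp
  finally have "card V * card (ksubsets V k) \<le>
      card V * (card (ksubsets (V - A) k) + (\<Sum>a\<in>A. card {B \<in> ksubsets V k. a \<in> B}))"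
    by simp
  also have "\<dots> = card V * card (ksubsets (V - A) k) +
      (\<Sum>a\<in>A. card V * card {B \<in> ksubsets V k. a \<in> B})"
    by (simp add: algebra_simps sum_distrib_left)
  also have "(\<Sum>a\<in>A. card V * card {B \<in> ksubsets V k. a \<in> B}) = (\<Sum>a\<in>A. k * card (ksubsets V k))"
    using assms A by (intro sum.cong) (auto simp: card_ksubsets_star)
  also have "\<dots> = k\<^sup>2 * card (ksubsets V k)"
    using A by (simp add: power2_eq_square)
  finally show ?thesis .
qed

text \<open>Shaped for the case of a large colour class: divided by \<open>2 * (card V - k)\<close>,
  it bounds half the number of vertices by \<open>d - 2 * s\<close>, where \<open>d\<close> is the
  degree and \<open>s = d * k / (card V - k)\<close> counts the neighbours in the star of
  \<open>v\<close> of a vertex avoiding \<open>v\<close>.\<close>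

lemma kneser_degree_bound:
  assumes "finite V" "0 < k" "card V \<ge> 3 * k\<^sup>2 + 7 * k"
  shows "real (card V choose k) * (card V - k) \<le> 2 * real ((card V - k) choose k) * (real (card V) - 3 * real k)"
proof -
  define N where "N = card V"
  have "k \<le> card V" using assms by linarith
  then obtain A where A: "A \<subseteq> V" "card A = k"
    using obtain_subset_with_card_n by metis
  then have "A \<in> ksubsets V k" by (simp add: ksubsets_def)
  from card_ksubsets_meeting[OF assms(1) this assms(2)]
  have "N * (N choose k) \<le> N * ((N - k) choose k) + k\<^sup>2 * (N choose k)"
    using A assms(1) by (simp add: card_ksubsets card_Diff_subset finite_subset N_def)
  then have "real (N * (N choose k)) \<le> real (N * ((N - k) choose k) + k\<^sup>2 * (N choose k))"
    using of_nat_le_iff by blast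
  then have 1: "real N * real (N choose k) \<le> real N * real ((N - k) choose k) + real k ^ 2 * real (N choose k)"
    by simp
  define m d where "m = real (N choose k)" and "d = real ((N - k) choose k)"
  have nn: "m \<ge> 0" "d \<ge> 0" by (auto simp: m_def d_def)
  have "real N \<ge> real (3 * k\<^sup>2 + 7 * k)" using assms unfolding N_def of_nat_le_iff by simp
  then have N: "real N \<ge> 3 * real k ^ 2 + 7 * real k" by simp
  have kk: "real k \<ge> 1" using assms by simp
  have kk2: "real k ^ 2 \<ge> real k" using kk by (simp add: power2_eq_square)
  \<comment> \<open>At most a third of all k-subsets meet \<open>A\<close>, hence \<open>d\<close>
    is at least \<open>2 / 3 * m\<close>.\<close>
  have "3 * (real k ^ 2 * m) \<le> real N * m"
    using mult_right_mono[of "3 * real k ^ 2" "real N" m] N kk nn by simp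
  then have "2 * (real N * m) \<le> 3 * (real N * d)"
    using 1 unfolding m_def d_def by linarith
  then have "real N * (2 * m) \<le> real N * (3 * d)" by (simp add: algebra_simps)
  moreover have "real N > 0" using N kk kk2 by linarith
  ultimately have d: "2 * m \<le> 3 * d" by simp
  have "2 * (m * (real N - real k)) = (2 * m) * (real N - real k)" by simp
  also have "\<dots> \<le> (3 * d) * (real N - real k)"
    using d N kk kk2 by (intro mult_right_mono) linarith+
  also have "\<dots> = d * (3 * (real N - real k))" by simp
  also have "\<dots> \<le> d * (4 * (real N - 3 * real k))"
  proof (rule mult_left_mono)
    \<comment> \<open>The goal amounts to \<open>9 * k \<le> N\<close>.\<close>
    have "10 * real k \<le> real N" using N kk2 by linarith
    then show "3 * (real N - real k) \<le> 4 * (real N - 3 * real k)" by simp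
  qed (rule nn)
  finally have "m * (real N - real k) \<le> 2 * d * (real N - 3 * real k)" by (simp add: algebra_simps)
  then show ?thesis
    using \<open>k \<le> card V\<close> unfolding m_def d_def N_def by (simp add: of_nat_diff)
qed

section \<open>Bichromatic edges of the Kneser graph\<close>

lemma sum_card_swap_disjoint:
  fixes P Q :: "'a set set"
  assumes "finite P" "finite Q"
  shows "(\<Sum>A\<in>P. card {B \<in> Q. A \<inter> B = {}}) = (\<Sum>B\<in>Q. card {A \<in> P. B \<inter> A = {}})"
proof -
  have "(\<Sum>A\<in>P. card {B \<in> Q. A \<inter> B = {}}) = (\<Sum>A\<in>P. \<Sum>B\<in>Q. if A \<inter> B = {} then 1 else 0)"
    using assms by (intro sum.cong) (auto simp: sum.If_cases Int_def)
  also have "\<dots> = (\<Sum>B\<in>Q. \<Sum>A\<in>P. if A \<inter> B = {} then 1 else 0)"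
    by (rule sum.swap)
  also have "\<dots> = (\<Sum>B\<in>Q. card {A \<in> P. A \<inter> B = {}})"
    using assms by (intro sum.cong) (auto simp: sum.If_cases Int_def)
  finally show ?thesis by (simp add: Int_commute)
qed

text \<open>Edges are counted as ordered pairs, hence twice, on both sides: the product of the two
  binomials is the number of ordered disjoint pairs.\<close>

lemma kneser_bichromatic_pairs:
  fixes c :: "'a set \<Rightarrow> 'a"
  assumes fin: "finite V" and k: "0 < k" and N: "card V \<ge> 3 * k\<^sup>2 + 7 * k"
    and c: "\<And>B. B \<in> ksubsets V k \<Longrightarrow> c B \<in> V - B"
  shows "2 * real k * real (card V choose k) * real ((card V - k) choose k) \<le>
    real (card V) * (\<Sum>A\<in>ksubsets V k. real (card {B \<in> ksubsets V k. A \<inter> B = {} \<and> c A \<noteq> c B}))"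
proof -
  define K where "K = ksubsets V k"
  define M where "M = real (card V choose k)"
  define d where "d = real ((card V - k) choose k)"
  define nb where "nb = (\<lambda>A. {B \<in> K. A \<inter> B = {}})"
  have finK: "finite K" unfolding K_def using fin by simp
  have cardK: "real (card K) = M" unfolding K_def M_def using fin by (simp add: card_ksubsets)
  have Asub: "A \<subseteq> V" "finite A" "card A = k" if "A \<in> K" for A
    using that fin finite_subset by (auto simp: K_def ksubsets_def)
  have nb: "real (card (nb A)) = d" if "A \<in> K" for A
    unfolding nb_def K_def ksubsets_disjoint d_def using Asub[OF that] fin
    by (simp add: card_ksubsets card_Diff_subset)
  have kV: "k \<le> card V" and NR: "real (card V) \<ge> 10 * real k"
  proof -
    have "k \<le> k\<^sup>2" using k by (simp add: power2_eq_square)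
    then have "10 * k \<le> card V" using N by linarith
    then show "real (card V) \<ge> 10 * real k" by linarith
    show "k \<le> card V" using N by linarith
  qed
  have kpos: "real k > 0" using k by simp
  have nn: "M \<ge> 0" "d \<ge> 0" by (auto simp: M_def d_def)
  have deg: "M * (real (card V) - k) \<le> 2 * d * (real (card V) - 3 * real k)"
    using kneser_degree_bound[OF fin k N] kV unfolding M_def d_def by (simp add: of_nat_diff)
  \<comment> \<open>Rearranged, \<open>d - M / 2\<close> is at least
    \<open>2 * k * d / card V\<close>, which is what small colour classes require. It follows from
    \<open>deg\<close> because \<open>(x - 3 * k) * x \<le> (x - 2 * k) * (x - k)\<close>.\<close>
  have half: "M * real (card V) \<le> 2 * d * (real (card V) - 2 * real k)"
  proof -
    have "M * (real (card V) * (real (card V) - k)) \<le> (2 * d * (real (card V) - 3 * real k)) * real (card V)"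
      using mult_right_mono[OF deg, of "real (card V)"] by (simp add: algebra_simps)
    also have "\<dots> \<le> 2 * d * (real (card V) - 2 * real k) * (real (card V) - k)"
    proof -
      have "(real (card V) - 3 * real k) * real (card V) \<le> (real (card V) - 2 * real k) * (real (card V) - k)"
        by (simp add: algebra_simps)
      from mult_left_mono[OF this, of "2 * d"] show ?thesis using nn by (simp add: mult.assoc)
    qed
    finally have "M * real (card V) * (real (card V) - k) \<le>
      2 * d * (real (card V) - 2 * real k) * (real (card V) - k)" by (simp add: mult.assoc)
    then show ?thesis using NR kpos by (subst (asm) mult_le_cancel_right_pos) linarith+
  qed
  define bad where "bad = (\<lambda>A. {B \<in> K. A \<inter> B = {} \<and> c A \<noteq> c B})"
  have finbad: "finite (bad A)" for A unfolding bad_def using finK by simp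
  have "2 * real k * M * d \<le> real (card V) * (\<Sum>A\<in>K. real (card (bad A)))"
  proof (cases "\<exists>v\<in>V. M < 2 * real (card {B\<in>K. c B = v})")
    case False
    have "d - M / 2 \<le> real (card (bad A))" if "A \<in> K" for A
    proof -
      have "nb A \<subseteq> bad A \<union> {B\<in>K. c B = c A}" unfolding nb_def bad_def by auto
      then have "card (nb A) \<le> card (bad A \<union> {B\<in>K. c B = c A})"
        using finK finbad by (intro card_mono) auto
      also have "\<dots> \<le> card (bad A) + card {B\<in>K. c B = c A}" by (rule card_Un_le)
      finally have "real (card (nb A)) \<le> real (card (bad A)) + real (card {B\<in>K. c B = c A})" by linarith
      moreover have "\<not> M < 2 * real (card {B\<in>K. c B = c A})"
        using False c[of A] that unfolding K_def by blast
      ultimately show ?thesis using nb[OF that] by linarith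
    qed
    then have "(\<Sum>A\<in>K. d - M / 2) \<le> (\<Sum>A\<in>K. real (card (bad A)))" by (rule sum_mono)
    then have "M * (d - M / 2) \<le> (\<Sum>A\<in>K. real (card (bad A)))" using cardK by simp
    then have 1: "real (card V) * (M * (d - M / 2)) \<le> real (card V) * (\<Sum>A\<in>K. real (card (bad A)))"
      by (rule mult_left_mono) simp
    have "M * (M * real (card V)) \<le> M * (2 * d * (real (card V) - 2 * real k))"
      by (rule mult_left_mono[OF half nn(1)])
    then have "2 * real k * M * d \<le> real (card V) * (M * (d - M / 2))"
      by (simp add: algebra_simps)
    then show ?thesis using 1 by linarith
  next
    case True
    then obtain v where v: "v \<in> V" and big: "M < 2 * real (card {B\<in>K. c B = v})" by blast
    define C where "C = {B\<in>K. c B = v}"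
    define S where "S = {B\<in>K. v \<in> B}"
    define W where "W = {B\<in>K. v \<notin> B \<and> c B \<noteq> v}"
    define s where "s = d * real k / (real (card V) - k)"
    have vC: "v \<notin> B" if "B \<in> C" for B
      using that c unfolding C_def K_def by fastforce
    have split: "K = S \<union> W \<union> C" unfolding S_def W_def C_def by auto
    have disj: "S \<inter> W = {}" "S \<inter> C = {}" "W \<inter> C = {}"
      using vC unfolding S_def W_def by (auto simp: C_def)
    have fins: "finite S" "finite W" "finite C" using finK unfolding S_def W_def C_def by auto
    have "card K = card S + card W + card C"
      unfolding split using fins disj by (subst card_Un_disjoint; simp add: Int_Un_distrib2)+
    then have W: "2 * real (card W) \<le> M" using big cardK unfolding C_def by linarith
    have S: "real (card V) * real (card S) = real k * M"
    proof -
      have "card V * card S = k * card K"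
        using card_ksubsets_star[OF fin v k] unfolding S_def K_def .
      then show ?thesis using cardK by (metis of_nat_mult)
    qed
    \<comment> \<open>The neighbours of \<open>A\<close> in the star of \<open>v\<close> form the
      star of \<open>v\<close> within \<open>V - A\<close>, a fraction
      \<open>k / (card V - k)\<close> of all \<open>d\<close> neighbours.\<close>
    have nbS: "real (card {B\<in>S. A \<inter> B = {}}) = s" if "A \<in> W" for A
    proof -
      have A: "A \<in> K" "v \<notin> A" using that unfolding W_def by auto
      have eq: "{B\<in>S. A \<inter> B = {}} = {B \<in> ksubsets (V - A) k. v \<in> B}"
        unfolding S_def K_def ksubsets_def by auto
      have "card (V - A) = card V - k" using Asub[OF A(1)] by (simp add: card_Diff_subset)
      moreover have "card (ksubsets (V - A) k) = (card V - k) choose k"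
        using fin calculation by (simp add: card_ksubsets)
      ultimately have "(card V - k) * card {B\<in>S. A \<inter> B = {}} = k * ((card V - k) choose k)"
        using card_ksubsets_star[of "V - A" v k] A v k fin unfolding eq by simp
      then have "real (card V - k) * real (card {B\<in>S. A \<inter> B = {}}) = real k * d"
        unfolding d_def by (metis of_nat_mult)
      then have "(real (card V) - k) * real (card {B\<in>S. A \<inter> B = {}}) = real k * d"
        using kV by (simp add: of_nat_diff)
      moreover have "real (card V) - k > 0" using NR kpos by linarith
      ultimately show ?thesis unfolding s_def by (simp add: field_simps)
    qed
    have ds: "M / 2 \<le> d - 2 * s"
    proof -
      have p: "real (card V) - k > 0" using NR kpos by linarith
      have "d - 2 * s = d * (real (card V) - 3 * real k) / (real (card V) - k)"
        using p unfolding s_def by (simp add: field_simps)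
      then show ?thesis using deg p by (simp add: pos_le_divide_eq)
    qed
    have nbsplit: "real (card {B\<in>C. A \<inter> B = {}}) =
        d - real (card {B\<in>S. A \<inter> B = {}}) - real (card {B\<in>W. A \<inter> B = {}})" if "A \<in> K" for A
    proof -
      have "nb A = {B\<in>S. A \<inter> B = {}} \<union> {B\<in>W. A \<inter> B = {}} \<union> {B\<in>C. A \<inter> B = {}}"
        unfolding nb_def split by auto
      moreover have "card \<dots> = card {B\<in>S. A \<inter> B = {}} + card {B\<in>W. A \<inter> B = {}} + card {B\<in>C. A \<inter> B = {}}"
        using fins disj by (subst card_Un_disjoint; auto)+
      ultimately show ?thesis using nb[OF that] by simp
    qed
    have SK: "S \<subseteq> K" "W \<subseteq> K" "C \<subseteq> K" unfolding S_def W_def C_def by auto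
    \<comment> \<open>The star is independent, so its vertices send all their edges to
      \<open>W\<close> and \<open>C\<close>. Those to \<open>W\<close> are counted from the other
      end, where each vertex has exactly \<open>s\<close> of them.\<close>
    have eSC: "(\<Sum>A\<in>S. real (card {B\<in>C. A \<inter> B = {}})) = real (card S) * d - real (card W) * s"
    proof -
      have "{B\<in>S. A \<inter> B = {}} = {}" if "A \<in> S" for A using that unfolding S_def by auto
      then have "(\<Sum>A\<in>S. real (card {B\<in>C. A \<inter> B = {}})) =
          (\<Sum>A\<in>S. d - real (card {B\<in>W. A \<inter> B = {}}))"
        using SK nbsplit by (intro sum.cong) (auto simp del: Collect_empty_eq)
      also have "\<dots> = real (card S) * d - real (\<Sum>A\<in>S. card {B\<in>W. A \<inter> B = {}})"
        by (simp add: sum_subtractf)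
      also have "(\<Sum>A\<in>S. card {B\<in>W. A \<inter> B = {}}) = (\<Sum>B\<in>W. card {A\<in>S. B \<inter> A = {}})"
        using fins by (intro sum_card_swap_disjoint)
      also have "real \<dots> = real (card W) * s" using nbS by simp
      finally show ?thesis .
    qed
    \<comment> \<open>Of its \<open>d\<close> neighbours, a vertex of \<open>W\<close> has
      \<open>s\<close> in the star and at most \<open>card W\<close> in \<open>W\<close>.\<close>
    have eWC: "real (card W) * (d - s - real (card W)) \<le> (\<Sum>A\<in>W. real (card {B\<in>C. A \<inter> B = {}}))"
    proof -
      have "d - s - real (card W) \<le> real (card {B\<in>C. A \<inter> B = {}})" if "A \<in> W" for A
      proof -
        have "card {B\<in>W. A \<inter> B = {}} \<le> card W" using fins by (intro card_mono) auto
        then show ?thesis using nbsplit[of A] nbS[OF that] that SK by auto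
      qed
      then have "(\<Sum>A\<in>W. d - s - real (card W)) \<le> (\<Sum>A\<in>W. real (card {B\<in>C. A \<inter> B = {}}))"
        by (rule sum_mono)
      then show ?thesis by simp
    qed
    \<comment> \<open>This is the surplus over \<open>card S * d\<close> in the sum of
      \<open>eSC\<close> and \<open>eWC\<close>; the factor is nonnegative since
      \<open>card W \<le> M / 2 \<le> d - 2 * s\<close>.\<close>
    have "0 \<le> real (card W) * (d - 2 * s - real (card W))"
      using ds W by (intro mult_nonneg_nonneg) auto
    then have low: "real (card S) * d \<le> (\<Sum>A\<in>S \<union> W. real (card {B\<in>C. A \<inter> B = {}}))"
      using eSC eWC fins disj by (simp add: sum.union_disjoint algebra_simps)
    \<comment> \<open>Every edge between \<open>S \<union> W\<close> and \<open>C\<close> is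
      bichromatic. It is counted once from each end, which yields the factor 2.\<close>
    have "(\<Sum>A\<in>S \<union> W. real (card {B\<in>C. A \<inter> B = {}})) \<le> (\<Sum>A\<in>S \<union> W. real (card (bad A)))"
    proof (rule sum_mono, unfold of_nat_le_iff, rule card_mono)
      fix A assume A: "A \<in> S \<union> W"
      then have "c A \<noteq> v" using disj SK unfolding C_def by auto
      then show "{B\<in>C. A \<inter> B = {}} \<subseteq> bad A" unfolding bad_def C_def by auto
    qed (rule finbad)
    moreover have "(\<Sum>A\<in>S \<union> W. real (card {B\<in>C. A \<inter> B = {}})) \<le> (\<Sum>A\<in>C. real (card (bad A)))"
    proof -
      have "(\<Sum>A\<in>S \<union> W. card {B\<in>C. A \<inter> B = {}}) = (\<Sum>A\<in>C. card {B\<in>S \<union> W. A \<inter> B = {}})"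
        using fins by (intro sum_card_swap_disjoint) auto
      also have "\<dots> \<le> (\<Sum>A\<in>C. card (bad A))"
      proof (rule sum_mono, rule card_mono)
        fix A assume A: "A \<in> C"
        show "{B\<in>S \<union> W. A \<inter> B = {}} \<subseteq> bad A"
        proof clarify
          fix B assume "B \<in> S \<union> W" "A \<inter> B = {}"
          moreover from this have "c B \<noteq> v" using disj SK unfolding C_def by auto
          ultimately show "B \<in> bad A" using A SK unfolding bad_def C_def by auto
        qed
      qed (rule finbad)
      finally show ?thesis by (simp flip: of_nat_sum)
    qed
    moreover have "(\<Sum>A\<in>K. real (card (bad A))) = (\<Sum>A\<in>S \<union> W. real (card (bad A))) + (\<Sum>A\<in>C. real (card (bad A)))"
      unfolding split using fins disj by (intro sum.union_disjoint) auto
    ultimately have "2 * (real (card S) * d) \<le> (\<Sum>A\<in>K. real (card (bad A)))"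
      using low by linarith
    then have "real (card V) * (2 * (real (card S) * d)) \<le> real (card V) * (\<Sum>A\<in>K. real (card (bad A)))"
      by (rule mult_left_mono) simp
    moreover have "real (card V) * (2 * (real (card S) * d)) = 2 * (real (card V) * real (card S)) * d"
      by simp
    ultimately show ?thesis unfolding S by (simp add: mult.assoc)
  qed
  then show ?thesis unfolding bad_def K_def M_def d_def .
qed

section \<open>Total variation distance of uniform laws on complements\<close>

lemma measurable_diagonal_borel: "measurable_diagonal (borel :: real measure)"
  unfolding measurable_diagonal_def by measurable

text \<open>Both laws have the same normalisation, so on an event \<open>E\<close> they differ only
  through the removed points in \<open>E\<close>, by
  \<open>card (B \<inter> E) - card (A \<inter> E)\<close> up to scaling. By disjointness
  \<open>E = B\<close> attains the maximum \<open>k\<close>.\<close>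

lemma tv_dist_uniform_complements:
  fixes V A B :: "real set"
  assumes "finite V" "A \<subseteq> V" "B \<subseteq> V" "A \<inter> B = {}" "card A = k" "card B = k" "k < card V"
  shows "tv_dist borel (measure_pmf (pmf_of_set (V - A))) (\<lambda>x. x) (measure_pmf (pmf_of_set (V - B))) (\<lambda>x. x)
    = real k / real (card V - k)"
proof -
  have fin: "finite A" "finite B" using assms finite_subset by auto
  have meas: "measure (distr (measure_pmf (pmf_of_set (V - D))) borel (\<lambda>x. x)) E
      = (real (card (V \<inter> E)) - real (card (D \<inter> E))) / real (card V - k)"
    if "E \<in> sets borel" "D \<subseteq> V" "card D = k" for D E :: "real set"
  proof -
    have fD: "finite D" using that assms finite_subset by auto
    have ne: "V - D \<noteq> {}" using that assms fD by (metis Diff_eq_empty_iff card_mono leD)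
    have "measure (distr (measure_pmf (pmf_of_set (V - D))) borel (\<lambda>x. x)) E
       = measure (measure_pmf (pmf_of_set (V - D))) E"
      using that by (subst measure_distr) auto
    also have "\<dots> = real (card ((V - D) \<inter> E)) / real (card (V - D))"
      using ne assms by (subst measure_pmf_of_set) auto
    also have "(V - D) \<inter> E = V \<inter> E - D \<inter> E" by auto
    also have "card \<dots> = card (V \<inter> E) - card (D \<inter> E)"
      using that fD by (intro card_Diff_subset) auto
    also have "real \<dots> = real (card (V \<inter> E)) - real (card (D \<inter> E))"
      using that assms by (intro of_nat_diff card_mono) auto
    also have "card (V - D) = card V - k"
      using that fD by (simp add: card_Diff_subset)
    finally show ?thesis .
  qed
  have pos: "real (card V - k) > 0" using assms by simp
  have diff: "\<bar>measure (distr (measure_pmf (pmf_of_set (V - A))) borel (\<lambda>x. x)) E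
      - measure (distr (measure_pmf (pmf_of_set (V - B))) borel (\<lambda>x. x)) E\<bar>
      = \<bar>real (card (B \<inter> E)) - real (card (A \<inter> E))\<bar> / real (card V - k)"
    if "E \<in> sets borel" for E
  proof -
    have "(real (card (V \<inter> E)) - real (card (A \<inter> E))) / real (card V - k) -
        (real (card (V \<inter> E)) - real (card (B \<inter> E))) / real (card V - k) =
        (real (card (B \<inter> E)) - real (card (A \<inter> E))) / real (card V - k)"
      by (simp flip: diff_divide_distrib)
    then show ?thesis using pos meas[OF that] assms by (simp add: abs_divide)
  qed
  have le: "\<bar>real (card (B \<inter> E)) - real (card (A \<inter> E))\<bar> \<le> real k" for E
  proof -
    have "card (B \<inter> E) \<le> card B" "card (A \<inter> E) \<le> card A" using fin by (auto intro: card_mono)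
    then show ?thesis using assms by linarith
  qed
  show ?thesis
    unfolding tv_dist_def
  proof (rule cSup_eq_maximum)
    have "B \<in> sets borel" using fin by (simp add: borel_closed finite_imp_closed)
    moreover have "real k / real (card V - k) = \<bar>real (card (B \<inter> B)) - real (card (A \<inter> B))\<bar> / real (card V - k)"
      using assms by simp
    ultimately show "real k / real (card V - k) \<in>
      (\<lambda>E. \<bar>measure (distr (measure_pmf (pmf_of_set (V - A))) borel (\<lambda>x. x)) E
      - measure (distr (measure_pmf (pmf_of_set (V - B))) borel (\<lambda>x. x)) E\<bar>) ` sets borel"
      using diff[of B] by (intro image_eqI[of _ _ B]) auto
  next
    fix x assume "x \<in> (\<lambda>E. \<bar>measure (distr (measure_pmf (pmf_of_set (V - A))) borel (\<lambda>x. x)) E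
      - measure (distr (measure_pmf (pmf_of_set (V - B))) borel (\<lambda>x. x)) E\<bar>) ` sets borel"
    then obtain E where "E \<in> sets borel"
      "x = \<bar>real (card (B \<inter> E)) - real (card (A \<inter> E))\<bar> / real (card V - k)"
      using diff by auto
    then show "x \<le> real k / real (card V - k)"
      using le[of E] pos by (simp add: divide_right_mono)
  qed
qed

section \<open>Averaging over a coupling\<close>

theorem proposition11:
  fixes f :: "real \<Rightarrow> real" and k n :: int
  assumes "disagreement_bound f"
    and "k \<ge> 2"
    and "n \<ge> 3 * k^2 + 6 * k"
  shows "f (real_of_int k / real_of_int n) \<ge> 2 * real_of_int k / (real_of_int n + real_of_int k)"
proof -
  define k' n' where "k' = nat k" and "n' = nat n"
  have "n \<ge> 0" using assms(2,3) zero_le_power2[of k] by linarith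
  then have kn: "k = int k'" "n = int n'" using assms(2) unfolding k'_def n'_def by auto
  have kpos: "0 < k'" using assms kn by simp
  have "int n' \<ge> int (3 * k'\<^sup>2 + 6 * k')" using assms unfolding kn by simp
  then have n': "n' \<ge> 3 * k'\<^sup>2 + 6 * k'" unfolding of_nat_le_iff .
  \<comment> \<open>With \<open>n + k\<close> points, the bound on \<open>n\<close> becomes
    \<open>3 * k^2 + 7 * k \<le> card V\<close>, and a complement of a k-subset has \<open>n\<close>
    points.\<close>
  define V :: "real set" where "V = real ` {..<n' + k'}"
  have finV: "finite V" unfolding V_def by simp
  have cardV: "card V = n' + k'" unfolding V_def by (simp add: card_image)
  have big: "card V \<ge> 3 * k'\<^sup>2 + 7 * k'" and klt: "k' < card V" using n' kpos cardV by auto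
  define K where "K = ksubsets V k'"
  have finK: "finite K" unfolding K_def using finV by simp
  have Ksub: "A \<subseteq> V" "card A = k'" "finite A" if "A \<in> K" for A
    using that finV finite_subset unfolding K_def ksubsets_def by auto
  \<comment> \<open>The family of variables has to be indexed by natural numbers, so the vertices
    are enumerated by \<open>e\<close>, with inverse \<open>idx\<close>.\<close>
  obtain e where e: "bij_betw e {0..<card K} K" using ex_bij_betw_nat_finite[OF finK] by blast
  define idx where "idx = the_inv_into {0..<card K} e"
  have idx: "idx A < card K" "e (idx A) = A" if "A \<in> K" for A
    using bij_betwE[OF bij_betw_the_inv_into[OF e]] f_the_inv_into_f_bij_betw[OF e, of A] that
    unfolding idx_def by auto
  define I where "I = {0..<card K}"
  define M where "M = (\<lambda>i. measure_pmf (pmf_of_set (V - e i)))"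
  define X where "X = (\<lambda>i::nat. \<lambda>x::real. x)"
  have fin: "finite I" unfolding I_def by simp
  have rv: "\<forall>i\<in>I. prob_space (M i) \<and> X i \<in> M i \<rightarrow>\<^sub>M borel"
    unfolding M_def X_def by (auto intro: measure_pmf.prob_space_axioms)
  have "\<exists>(P :: (nat \<Rightarrow> real) measure) X'. is_coupling borel I M X P X' \<and>
      (\<forall>i\<in>I. \<forall>j\<in>I. i \<noteq> j \<longrightarrow>
        measure P {\<omega> \<in> space P. X' i \<omega> \<noteq> X' j \<omega>} \<le> f (tv_dist borel (M i) (X i) (M j) (X j)))"
    using assms(1)[unfolded disagreement_bound_def, THEN conjunct2, rule_format,
        OF measurable_diagonal_borel fin, of M X] rv by blast
  then obtain P :: "(nat \<Rightarrow> real) measure" and X' where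
    coup: "is_coupling borel I M X P X'" and
    bound: "\<And>i j. i \<in> I \<Longrightarrow> j \<in> I \<Longrightarrow> i \<noteq> j \<Longrightarrow>
      measure P {\<omega> \<in> space P. X' i \<omega> \<noteq> X' j \<omega>} \<le> f (tv_dist borel (M i) (X i) (M j) (X j))"
    by blast
  interpret P: prob_space P using coup unfolding is_coupling_def by blast
  define Y where "Y = (\<lambda>A. X' (idx A))"
  have Ym: "Y A \<in> borel_measurable P" if "A \<in> K" for A
    using coup idx[OF that] unfolding is_coupling_def I_def Y_def by auto
  have Yd: "distr P borel (Y A) = distr (measure_pmf (pmf_of_set (V - A))) borel (\<lambda>x. x)" if "A \<in> K" for A
    using coup idx[OF that] unfolding is_coupling_def I_def Y_def M_def X_def by auto
  have Yf: "measure P {\<omega> \<in> space P. Y A \<omega> \<noteq> Y B \<omega>} \<le> f (k / n)"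
    if "A \<in> K" "B \<in> K" "A \<inter> B = {}" for A B
  proof -
    \<comment> \<open>The disagreement bound concerns distinct indices; disjoint sets are distinct
      because they are nonempty.\<close>
    have "A \<noteq> B" using that Ksub kpos by fastforce
    then have "idx A \<noteq> idx B" using that idx by metis
    then have "measure P {\<omega> \<in> space P. Y A \<omega> \<noteq> Y B \<omega>} \<le>
       f (tv_dist borel (measure_pmf (pmf_of_set (V - A))) (\<lambda>x. x) (measure_pmf (pmf_of_set (V - B))) (\<lambda>x. x))"
      using bound[of "idx A" "idx B"] that idx unfolding Y_def I_def M_def X_def by simp
    then show ?thesis
      using tv_dist_uniform_complements[OF finV, of A B k'] that Ksub klt cardV kn by simp
  qed
  \<comment> \<open>A coupling fixes only the laws, so the colours are admissible almost surely;
    finiteness of \<open>K\<close> then gives one null set for all vertices.\<close>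
  have Ysupp: "AE \<omega> in P. Y A \<omega> \<in> V - A" if "A \<in> K" for A
  proof -
    have ne: "V - A \<noteq> {}" using Ksub[OF that] klt by (metis Diff_eq_empty_iff card_mono leD)
    have "V - A \<in> sets borel" using finV by (simp add: borel_closed finite_imp_closed)
    then have meas: "{x \<in> space borel. x \<in> V - A} \<in> sets borel" by (simp add: set_diff_eq)
    have "AE x in distr (measure_pmf (pmf_of_set (V - A))) borel (\<lambda>x. x). x \<in> V - A"
      using ne finV by (subst AE_distr_iff[OF _ meas]) (auto simp: AE_measure_pmf_iff)
    then have "AE x in distr P borel (Y A). x \<in> V - A" unfolding Yd[OF that] .
    then show ?thesis
      using AE_distr_iff[OF Ym[OF that] meas] by blast
  qed
  then have "AE \<omega> in P. \<forall>A\<in>K. Y A \<omega> \<in> V - A"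
    using finK by (subst AE_finite_all) auto
  define D where "D = (SIGMA A:K. {B \<in> K. A \<inter> B = {}})"
  define ev where "ev = (\<lambda>(A,B). {\<omega> \<in> space P. Y A \<omega> \<noteq> Y B \<omega>})"
  have finD: "finite D" unfolding D_def using finK by auto
  have evs: "ev p \<in> sets P" if "p \<in> D" for p
  proof -
    obtain A B where p: "p = (A, B)" "A \<in> K" "B \<in> K" using \<open>p \<in> D\<close> unfolding D_def by auto
    show ?thesis
      unfolding p(1) ev_def prod.case by (rule borel_measurable_neq[OF Ym[OF p(2)] Ym[OF p(3)]])
  qed
  define m d where "m = real (card V choose k')" and "d = real ((card V - k') choose k')"
  have cardD: "real (card D) = m * d"
  proof -
    have "card {B \<in> K. A \<inter> B = {}} = (card V - k') choose k'" if "A \<in> K" for A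
      unfolding K_def ksubsets_disjoint using Ksub[OF that] finV
      by (simp add: card_ksubsets card_Diff_subset)
    then show ?thesis unfolding D_def m_def d_def using finK finV
      by (simp add: card_SigmaI card_ksubsets K_def)
  qed
  \<comment> \<open>Disjoint pairs exist, so the final inequality can be divided by their
    number.\<close>
  have pos: "m * d > 0"
  proof -
    have "k' \<le> card V - k'" using big by linarith
    then show ?thesis using klt unfolding m_def d_def by simp
  qed
  \<comment> \<open>For such a sample \<open>\<omega>\<close>, the map sending \<open>A\<close> to
    \<open>Y A \<omega>\<close> is an admissible colouring, and the indicators count its bichromatic
    ordered pairs.\<close>
  have pt: "2 * real k' * (m * d) / real (card V) \<le> (\<Sum>p\<in>D. indicator (ev p) \<omega>)"
    if "\<omega> \<in> space P" "\<forall>A\<in>K. Y A \<omega> \<in> V - A" for \<omega>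
  proof -
    have "2 * real k' * m * d \<le>
      real (card V) * (\<Sum>A\<in>K. real (card {B \<in> K. A \<inter> B = {} \<and> Y A \<omega> \<noteq> Y B \<omega>}))"
      using kneser_bichromatic_pairs[OF finV kpos big, of "\<lambda>A. Y A \<omega>"] that
      unfolding K_def m_def d_def by blast
    also have "(\<Sum>A\<in>K. real (card {B \<in> K. A \<inter> B = {} \<and> Y A \<omega> \<noteq> Y B \<omega>})) =
       (\<Sum>A\<in>K. \<Sum>B\<in>{B \<in> K. A \<inter> B = {}}. indicator (ev (A, B)) \<omega>)"
    proof (rule sum.cong[OF refl])
      fix A assume "A \<in> K"
      have "(\<Sum>B\<in>{B \<in> K. A \<inter> B = {}}. indicator (ev (A, B)) \<omega>) =
        (\<Sum>B\<in>{B \<in> K. A \<inter> B = {}}. if Y A \<omega> \<noteq> Y B \<omega> then 1 else (0::real))"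
        using that by (intro sum.cong) (auto simp: ev_def)
      also have "\<dots> = real (card ({B \<in> K. A \<inter> B = {}} \<inter> {B. Y A \<omega> \<noteq> Y B \<omega>}))"
        using finK by (subst sum.If_cases) auto
      also have "{B \<in> K. A \<inter> B = {}} \<inter> {B. Y A \<omega> \<noteq> Y B \<omega>} = {B \<in> K. A \<inter> B = {} \<and> Y A \<omega> \<noteq> Y B \<omega>}"
        by auto
      finally show "real (card {B \<in> K. A \<inter> B = {} \<and> Y A \<omega> \<noteq> Y B \<omega>}) =
        (\<Sum>B\<in>{B \<in> K. A \<inter> B = {}}. indicator (ev (A, B)) \<omega>)" by simp
    qed
    also have "\<dots> = (\<Sum>p\<in>D. indicator (ev p) \<omega>)"
      unfolding D_def using finK by (subst sum.Sigma) (auto simp: case_prod_beta)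
    finally show ?thesis using klt by (simp add: divide_le_eq mult_ac)
  qed
  \<comment> \<open>Integrating the pointwise bound gives a lower bound for the sum of the
    \<open>m * d\<close> disagreement probabilities, each at most \<open>f (k / n)\<close>.\<close>
  have "2 * real k' * (m * d) / real (card V) \<le> (\<integral>\<omega>. (\<Sum>p\<in>D. indicator (ev p) \<omega>) \<partial>P)"
  proof (rule P.integral_ge_const)
    show "integrable P (\<lambda>\<omega>. \<Sum>p\<in>D. indicator (ev p) \<omega> :: real)"
      using evs by (intro Bochner_Integration.integrable_sum) (auto simp: P.emeasure_eq_measure)
    show "AE \<omega> in P. 2 * real k' * (m * d) / real (card V) \<le> (\<Sum>p\<in>D. indicator (ev p) \<omega>)"
      using \<open>AE \<omega> in P. \<forall>A\<in>K. Y A \<omega> \<in> V - A\<close> AE_space by eventually_elim (use pt in blast)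
  qed
  also have "\<dots> = (\<Sum>p\<in>D. measure P (ev p))"
    using evs by (subst Bochner_Integration.integral_sum) (auto simp: P.emeasure_eq_measure)
  also have "\<dots> \<le> (\<Sum>p\<in>D. f (k / n))"
    using Yf by (intro sum_mono) (auto simp: D_def ev_def)
  also have "\<dots> = (m * d) * f (k / n)" using cardD by simp
  finally have "(m * d) * (2 * real k' / real (card V)) \<le> (m * d) * f (k / n)"
    by (simp add: mult_ac)
  then have "2 * real k' / real (card V) \<le> f (k / n)"
    using pos by (subst (asm) mult_le_cancel_left_pos)
  then show ?thesis using cardV kn by simp
qed

end
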